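(* Let $(a_p)_p$ be a sequence, indexed by primes, of integers with $0\leq a_p<p$ such that for Lebesgue-almost every $x\in[0,1]$ the inequality $|x-\frac{a_p}{p}|\leq\frac{1}{2p}$ holds for infinitely many primes $p$. Let $X=(\mathbf{R}/\mathbf{Z})^2$ with the Lebesgue probability measure $\mu$, let $f\colon X\to X$ be defined by $f(x,y)=(x+y,y)$, and let $\varphi\colon X\to\mathbf{C}$ be defined by $\varphi(x,y)=e(x)$. For $p$ prime and $n\in\mathbf{Z}$, put $t_p(n)=e(-na_p/p)$, and define $s_p\colon X\to\mathbf{C}$ by $$s_p(x,y)=\frac1p\sum_{0\leq n<p}t_p(n)\,\varphi(f^n(x,y)).$$ Then: (1) The sequence $(s_p)$ does not converge $\mu$-almost everywhere as $p\to+\infty$ along the primes. (2) If $\mathsf{P}$ is any infinite set of primes such that $\sum_{p\in\mathsf{P}}\frac{\log p}{p}<+\infty$, then the sequence $(s_p)_{p\in\mathsf{P}}$ converges $\mu$-almost everywhere to $0$.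
   Context: $e(x)=e^{2\pi i x}$, and $f^n$ denotes the $n$-th iterate of $f$. *)

theory Defs
  imports "HOL-Analysis.Analysis" "HOL-Probability.Probability_Measure"
    "HOL-Computational_Algebra.Primes"
begin

quotient_type circle = real / "\<lambda>x y :: real. x - y \<in> \<int>"
  morphisms rep_circle to_circle
proof (rule equivpI)
  show "reflp (\<lambda>x y :: real. x - y \<in> \<int>)"
    by (rule reflpI) simp
  show "symp (\<lambda>x y :: real. x - y \<in> \<int>)"
  proof (rule sympI)
    fix x y :: real
    assume "x - y \<in> \<int>"
    then have "- (x - y) \<in> \<int>" by (rule Ints_minus)
    then show "y - x \<in> \<int>" by simp
  qed
  show "transp (\<lambda>x y :: real. x - y \<in> \<int>)"
  proof (rule transpI)
    fix x y z :: real
    assume "x - y \<in> \<int>" "y - z \<in> \<int>"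
    then have "(x - y) + (y - z) \<in> \<int>" by (rule Ints_add)
    then show "x - z \<in> \<int>" by simp
  qed
qed

instantiation circle :: ab_group_add
begin

lift_definition zero_circle :: circle is "0 :: real" .

lift_definition plus_circle :: "circle \<Rightarrow> circle \<Rightarrow> circle" is "(+) :: real \<Rightarrow> real \<Rightarrow> real"
proof -
  fix a b c d :: real
  assume "a - b \<in> \<int>" "c - d \<in> \<int>"
  then have "(a - b) + (c - d) \<in> \<int>" by (rule Ints_add)
  then show "(a + c) - (b + d) \<in> \<int>" by (simp add: algebra_simps)
qed

lift_definition uminus_circle :: "circle \<Rightarrow> circle" is "uminus :: real \<Rightarrow> real"
proof -
  fix a b :: real
  assume "a - b \<in> \<int>"
  then have "- (a - b) \<in> \<int>" by (rule Ints_minus)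
  then show "- a - - b \<in> \<int>" by simp
qed

lift_definition minus_circle :: "circle \<Rightarrow> circle \<Rightarrow> circle" is "(-) :: real \<Rightarrow> real \<Rightarrow> real"
proof -
  fix a b c d :: real
  assume "a - b \<in> \<int>" "c - d \<in> \<int>"
  then have "(a - b) - (c - d) \<in> \<int>" by (rule Ints_diff)
  then show "(a - c) - (b - d) \<in> \<int>" by (simp add: algebra_simps)
qed

instance
  by standard (transfer, simp)+

end

text \<open>The quotient topology; it fixes the Borel \<open>\<sigma>\<close>-algebra on \<open>\<real>/\<int>\<close>.\<close>

instantiation circle :: topological_space
begin

definition open_circle :: "circle set \<Rightarrow> bool"
  where "open_circle U \<longleftrightarrow> open (to_circle -` U)"

instance
  by standard (auto simp: open_circle_def vimage_Union)

end

lemma continuous_on_to_circle: "continuous_on UNIV to_circle"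
  by (simp add: continuous_on_open_vimage open_circle_def)

lemma measurable_to_circle [measurable]: "to_circle \<in> borel_measurable borel"
  by (rule borel_measurable_continuous_onI) (rule continuous_on_to_circle)

definition circle_measure :: "circle measure"
  where "circle_measure = distr (restrict_space lborel {0..<1}) borel to_circle"

lemma measurable_to_circle_restrict:
  "to_circle \<in> restrict_space lborel {0..<1} \<rightarrow>\<^sub>M borel"
  by (rule measurable_restrict_space1) simp

lemma prob_space_circle_measure: "prob_space circle_measure"
proof -
  have "prob_space (restrict_space lborel {0..<1::real})"
    by (rule prob_spaceI) (simp add: space_restrict_space emeasure_restrict_space)
  then show ?thesis
    unfolding circle_measure_def
    by (rule prob_space.prob_space_distr) (rule measurable_to_circle_restrict)
qed

definition expi :: "real \<Rightarrow> complex"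
  where "expi x = exp (2 * of_real pi * \<i> * of_real x)"

lift_definition circle_expi :: "circle \<Rightarrow> complex" is expi
proof -
  fix x y :: real
  assume "x - y \<in> \<int>"
  then obtain n where "x - y = of_int n" by (elim Ints_cases)
  then have "x = y + of_int n" by simp
  then have "2 * of_real pi * \<i> * of_real x
      = 2 * of_real pi * \<i> * of_real y + (2 * of_int n * of_real pi) * \<i>"
    by (simp add: algebra_simps)
  then show "expi x = expi y"
    unfolding expi_def exp_eq by (auto simp: algebra_simps)
qed

definition torus_measure :: "(circle \<times> circle) measure"
  where "torus_measure = circle_measure \<Otimes>\<^sub>M circle_measure"

definition shear :: "circle \<times> circle \<Rightarrow> circle \<times> circle"
  where "shear = (\<lambda>(x, y). (x + y, y))"

definition phi :: "circle \<times> circle \<Rightarrow> complex"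
  where "phi = (\<lambda>(x, y). circle_expi x)"

definition weight :: "(nat \<Rightarrow> int) \<Rightarrow> nat \<Rightarrow> int \<Rightarrow> complex"
  where "weight a p n = expi (- of_int n * of_int (a p) / of_nat p)"

definition weighted_avg :: "(nat \<Rightarrow> int) \<Rightarrow> nat \<Rightarrow> circle \<times> circle \<Rightarrow> complex"
  where "weighted_avg a p z =
    1 / of_nat p * (\<Sum>n<p. weight a p (int n) * phi ((shear ^^ n) z))"

text \<open>The filter of neighbourhoods of \<open>+\<infinity>\<close> along a set of natural numbers; for infinite \<open>P\<close>,
  convergence with respect to it is convergence of the subsequence indexed by \<open>P\<close>.\<close>

definition at_top_along :: "nat set \<Rightarrow> nat filter"
  where "at_top_along P = inf at_top (principal P)"

end

theory Submission imports Defs begin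

text \<open>
  The modulus of \<open>s\<^sub>p(x, y)\<close> is the normalised Dirichlet kernel
  \<open>\<bar>(1/p) \<Sum>\<^sub>n\<^sub><\<^sub>p e(n t)\<bar>\<close> at \<open>t = y - a\<^sub>p/p\<close>, whose square is
  \<open>p\<^sup>-\<^sup>2 \<Sum>\<^sub>n \<Sum>\<^sub>m cos(2 \<pi> (n - m) t)\<close>. Integrating gives \<open>L\<^sup>2\<close>-norm squared \<open>1/p\<close>, so
  \<open>\<Sum> \<bar>s\<^sub>p\<bar>\<^sup>2\<close> is integrable over any set of primes with \<open>\<Sum> 1/p < \<infinity>\<close>, which yields (2).
  In particular the only possible limit along all primes is \<open>0\<close>; but \<open>\<bar>s\<^sub>p\<bar> \<ge> 1/3\<close>
  whenever \<open>\<bar>t\<bar> \<le> 1/(2p)\<close>, which happens for infinitely many \<open>p\<close> at almost every \<open>y\<close>.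
\<close>

section \<open>The normalised Dirichlet kernel: lower bound near 0 and mean square\<close>

lemma expi_eq_cis: "expi x = cis (2 * pi * x)"
  by (simp add: expi_def cis_conv_exp mult_ac)

lemma expi_add: "expi (x + y) = expi x * expi y"
  by (simp add: expi_eq_cis cis_mult distrib_left)

lemma norm_expi [simp]: "norm (expi x) = 1"
  by (simp add: expi_eq_cis)

text \<open>The real double cosine sum serves twice: each term has a quadratic minorant near 0, and
  each term has an explicit antiderivative.\<close>

lemma norm_sum_expi_squared:
  "(norm (\<Sum>n<p. expi (real n * t)))\<^sup>2 = (\<Sum>n<p. \<Sum>m<p. cos (2 * pi * (real n - real m) * t))"
proof -
  have "(norm (\<Sum>n<p. expi (real n * t)))\<^sup>2
      = (\<Sum>n<p. cos (2 * pi * (real n * t)))\<^sup>2 + (\<Sum>n<p. sin (2 * pi * (real n * t)))\<^sup>2"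
    by (simp add: cmod_power2 expi_eq_cis)
  also have "\<dots> = (\<Sum>n<p. \<Sum>m<p. cos (2 * pi * (real n * t) - 2 * pi * (real m * t)))"
    by (simp add: power2_eq_square sum_product sum.distrib cos_diff)
  also have "\<dots> = (\<Sum>n<p. \<Sum>m<p. cos (2 * pi * (real n - real m) * t))"
    by (intro sum.cong refl arg_cong[of _ _ cos]) (simp add: algebra_simps)
  finally show ?thesis .
qed

text \<open>Half-angle formula: 1 - cos x = 2 sin^2(x/2), and |sin u| \<le> |u|.\<close>

lemma cos_ge_quadratic: "1 - x\<^sup>2 / 2 \<le> cos (x :: real)"
proof -
  have "(sin (x / 2))\<^sup>2 \<le> (x / 2)\<^sup>2"
    using abs_sin_x_le_abs_x[of "x / 2"] by (simp add: abs_le_square_iff[symmetric])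
  then show ?thesis
    using cos_double_sin[of "x / 2"] by (simp add: power_divide)
qed

lemma sum_squared_differences:
  "(\<Sum>n<p. \<Sum>m<p. (real n - real m)\<^sup>2) = (real p)\<^sup>2 * ((real p)\<^sup>2 - 1) / 6"
proof -
  have s1: "(\<Sum>n<p. real n) = real p * (real p - 1) / 2"
    by (induction p) (simp_all add: field_simps)
  have s2: "(\<Sum>n<p. (real n)\<^sup>2) = real p * (real p - 1) * (2 * real p - 1) / 6"
    by (induction p) (simp_all add: field_simps power2_eq_square)
  have "(\<Sum>n<p. \<Sum>m<p. (real n - real m)\<^sup>2)
      = 2 * real p * (\<Sum>n<p. (real n)\<^sup>2) - 2 * (\<Sum>n<p. real n) * (\<Sum>m<p. real m)"
    by (simp add: power2_diff sum.distrib sum_subtractf sum_distrib_left[symmetric]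
        sum_distrib_right[symmetric] mult.assoc)
  then show ?thesis
    unfolding s1 s2 by (simp add: field_simps power2_eq_square)
qed

definition dirichlet_mean :: "nat \<Rightarrow> real \<Rightarrow> real"
  where "dirichlet_mean p t = norm (\<Sum>n<p. expi (real n * t)) / real p"

text \<open>For |t| of order 1/p the phases n t spread too little to cancel. Replacing every cosine
  by its quadratic minorant leaves p^2 minus a multiple of the sum of (n - m)^2, which is known in
  closed form.\<close>

lemma dirichlet_mean_ge:
  assumes p: "p > 0" and t: "\<bar>t\<bar> \<le> 1 / (2 * real p)"
  shows "1 / 3 \<le> dirichlet_mean p t"
proof -
  have "\<bar>t * (2 * real p)\<bar> \<le> 1"
    using p t by (simp add: abs_mult field_simps)
  then have "(t * (2 * real p))\<^sup>2 \<le> 1"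
    by (simp only: abs_square_le_1)
  then have tt: "4 * (real p)\<^sup>2 * t\<^sup>2 \<le> 1"
    by (simp add: power_mult_distrib mult_ac)
  have pi2: "pi\<^sup>2 \<le> 10"
    using mult_mono[of pi "3.15" pi "3.15"] pi_approx by (simp add: power2_eq_square)
  have square: "(2 * pi * d * t)\<^sup>2 / 2 = 2 * pi\<^sup>2 * t\<^sup>2 * d\<^sup>2" for d
    by (simp add: power_mult_distrib)
  have "(\<Sum>n<p. \<Sum>m<p. 1 - (2 * pi * (real n - real m) * t)\<^sup>2 / 2)
      \<le> (norm (\<Sum>n<p. expi (real n * t)))\<^sup>2"
    unfolding norm_sum_expi_squared by (intro sum_mono cos_ge_quadratic)
  also have "(\<Sum>n<p. \<Sum>m<p. 1 - (2 * pi * (real n - real m) * t)\<^sup>2 / 2)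
      = (real p)\<^sup>2 - 2 * pi\<^sup>2 * t\<^sup>2 * (\<Sum>n<p. \<Sum>m<p. (real n - real m)\<^sup>2)"
    by (simp add: sum_subtractf sum_distrib_left square power2_eq_square[of "real p"])
  finally have lower: "(real p)\<^sup>2 - 2 * pi\<^sup>2 * t\<^sup>2 * ((real p)\<^sup>2 * ((real p)\<^sup>2 - 1) / 6)
      \<le> (norm (\<Sum>n<p. expi (real n * t)))\<^sup>2"
    unfolding sum_squared_differences .
  have "2 * pi\<^sup>2 * t\<^sup>2 * ((real p)\<^sup>2 * ((real p)\<^sup>2 - 1) / 6)
      = pi\<^sup>2 * (4 * (real p)\<^sup>2 * t\<^sup>2) * ((real p)\<^sup>2 - 1) / 12"
    by (simp add: field_simps)
  \<comment> \<open>The loss is at most 10/12 of p^2, so at least p^2/6 survives. This exceeds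
    p^2/9, whose square root gives the round constant 1/3.\<close>
  also have "\<dots> \<le> 10 * 1 * (real p)\<^sup>2 / 12"
    using p by (intro divide_right_mono mult_mono pi2 tt) auto
  finally have "(real p)\<^sup>2 / 9 \<le> (norm (\<Sum>n<p. expi (real n * t)))\<^sup>2"
    using lower zero_le_power2[of "real p"] by linarith
  then have "(real p / 3)\<^sup>2 \<le> (norm (\<Sum>n<p. expi (real n * t)))\<^sup>2"
    by (simp add: power_divide)
  then have "real p / 3 \<le> norm (\<Sum>n<p. expi (real n * t))"
    by (rule power2_le_imp_le) simp
  then show ?thesis
    using p by (simp add: dirichlet_mean_def field_simps)
qed

lemma borel_measurable_dirichlet_mean [measurable]: "dirichlet_mean p \<in> borel_measurable borel"
proof -
  have [measurable]: "expi \<in> borel_measurable borel"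
    unfolding expi_def[abs_def] by (intro borel_measurable_continuous_onI continuous_intros)
  show ?thesis
    unfolding dirichlet_mean_def[abs_def] by measurable
qed

text \<open>Orthogonality of the characters, obtained from an explicit antiderivative. Off-diagonal
  terms vanish over a full period, whatever the shift \<open>c\<close>; the p diagonal terms
  contribute 1 each, divided by p^2.\<close>

lemma nn_integral_dirichlet_mean_squared:
  assumes p: "p > 0"
  shows "(\<integral>\<^sup>+y. ennreal ((dirichlet_mean p (y - c))\<^sup>2) * indicator {0..1} y \<partial>lborel) = 1 / real p"
proof -
  \<comment> \<open>\<open>G k\<close> is an antiderivative of cos(2 \<pi> k (y - c)). The case k =
    0 is the diagonal, where the integrand is the constant 1.\<close>
  define G where "G k y = (if k = 0 then y else sin (2 * pi * k * (y - c)) / (2 * pi * k))" for k y :: real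
  define F where "F y = (\<Sum>n<p. \<Sum>m<p. G (real n - real m) y) / (real p)\<^sup>2" for y
  have G: "(G k has_real_derivative cos (2 * pi * k * (y - c))) (at y)" for k y
    unfolding G_def by (cases "k = 0") (auto intro!: derivative_eq_intros)
  have F: "(F has_real_derivative (dirichlet_mean p (y - c))\<^sup>2) (at y)" for y
    unfolding F_def[abs_def] dirichlet_mean_def power_divide norm_sum_expi_squared
    by (intro DERIV_cdivide DERIV_sum G)
  have G1: "G (real n - real m) 1 - G (real n - real m) 0 = (if n = m then 1 else 0)" for n m :: nat
  proof (cases "n = m")
    case False
    \<comment> \<open>The frequency n - m is an integer, so moving y from 0 to 1 shifts the argument
      by a multiple of 2 \<pi>.\<close>
    have "sin (2 * pi * (real n - real m) * (1 - c))
        = sin (2 * pi * (real n - real m) * (0 - c) + 2 * pi * of_int (int n - int m))"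
      by (simp add: algebra_simps)
    also have "\<dots> = sin (2 * pi * (real n - real m) * (0 - c))"
      by (simp only: sin_add sin_int_2pin cos_int_2pin mult_1_right mult_zero_right add_0_right)
    finally show ?thesis
      using False by (simp add: G_def)
  qed (simp add: G_def)
  have "(\<integral>\<^sup>+y. ennreal ((dirichlet_mean p (y - c))\<^sup>2) * indicator {0..1} y \<partial>lborel) = F 1 - F 0"
    by (rule nn_integral_FTC_Icc) (auto intro: F has_field_derivative_at_within)
  also have "F 1 - F 0 = (\<Sum>n<p. \<Sum>m<p. if n = m then 1 else 0) / (real p)\<^sup>2"
    by (simp add: F_def diff_divide_distrib[symmetric] sum_subtractf[symmetric] G1)
  also have "\<dots> = 1 / real p"
    using p by (simp add: power2_eq_square)
  finally show ?thesis .
qed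

section \<open>Representatives in [0,1) and transfer of almost-everywhere statements\<close>

text \<open>\<open>rep_circle\<close> picks an arbitrary representative; taking \<open>frac\<close>
  normalises it, which makes the section measurable.\<close>

definition unit_rep :: "circle \<Rightarrow> real"
  where "unit_rep c = frac (rep_circle c)"

lemma to_circle_eq_iff: "to_circle x = to_circle y \<longleftrightarrow> x - y \<in> \<int>"
  by (rule circle.abs_eq_iff)

lemma to_circle_unit_rep [simp]: "to_circle (unit_rep c) = c"
proof -
  have "to_circle (unit_rep c) = to_circle (rep_circle c)"
    by (simp add: unit_rep_def to_circle_eq_iff frac_def)
  also have "\<dots> = c"
    by (rule Quotient_abs_rep[OF Quotient_circle])
  finally show ?thesis .
qed

lemma unit_rep_to_circle: "unit_rep (to_circle x) = frac x"
proof -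
  have "unit_rep (to_circle x) - x \<in> \<int>"
    by (simp flip: to_circle_eq_iff)
  then have "x - unit_rep (to_circle x) \<in> \<int>"
    using Ints_minus by fastforce
  moreover have "0 \<le> unit_rep (to_circle x)" "unit_rep (to_circle x) < 1"
    by (simp_all add: unit_rep_def frac_lt_1)
  ultimately show ?thesis
    by (metis frac_unique_iff)
qed

text \<open>\<open>frac\<close> jumps only at integers, where it is 0; for b \<ge> 0 these points
  are excluded and open intervals remain. In the quotient topology this makes the superlevel sets of
  \<open>unit_rep\<close> open.\<close>

lemma open_frac_greater:
  assumes "0 \<le> b"
  shows "open {y :: real. b < frac y}"
proof -
  have "{y :: real. b < frac y} = (\<Union>n::int. {of_int n + b<..<of_int n + 1})"
  proof (intro equalityI subsetI)
    fix y assume "y \<in> {y :: real. b < frac y}"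
    then have "y \<in> {of_int \<lfloor>y\<rfloor> + b<..<of_int \<lfloor>y\<rfloor> + 1}"
      using frac_lt_1[of y] by (auto simp: frac_def)
    then show "y \<in> (\<Union>n::int. {of_int n + b<..<of_int n + 1})" by blast
  next
    fix y assume "y \<in> (\<Union>n::int. {of_int n + b<..<of_int n + 1})"
    then obtain n :: int where n: "of_int n + b < y" "y < of_int n + 1" by auto
    then have "\<lfloor>y\<rfloor> = n" using assms by (intro floor_unique) auto
    then show "y \<in> {y :: real. b < frac y}" using n by (simp add: frac_def)
  qed
  then show ?thesis by auto
qed

lemma measurable_unit_rep [measurable]: "unit_rep \<in> borel_measurable borel"
  unfolding borel_measurable_iff_greater
proof
  fix b :: real
  show "{c \<in> space borel. b < unit_rep c} \<in> sets borel"
  proof (cases "0 \<le> b")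
    case True
    then have "open {c. b < unit_rep c}"
      using open_frac_greater[of b] by (simp add: open_circle_def unit_rep_to_circle)
    then show ?thesis by simp
  next
    case False
    then have "{c. b < unit_rep c} = UNIV"
      by (auto simp: unit_rep_def intro: less_le_trans[OF _ frac_ge_0])
    then show ?thesis by simp
  qed
qed

text \<open>\<open>Q\<close> may be non-measurable, so a measurable null set N covering its failures
  is moved instead. The preimage of N under \<open>unit_rep\<close> is null because
  \<open>unit_rep\<close> inverts \<open>to_circle\<close> on [0,1).\<close>

lemma AE_circle_measureI:
  assumes "AE y in restrict_space lborel {0..<1}. Q y"
  shows "AE c in circle_measure. Q (unit_rep c)"
proof -
  from assms obtain N where N: "{y \<in> space (restrict_space lborel {0..<1}). \<not> Q y} \<subseteq> N"
    "emeasure (restrict_space lborel {0..<1}) N = 0" "N \<in> sets (restrict_space lborel {0..<1})"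
    by (rule AE_E)
  have N': "N \<in> sets borel" "N \<subseteq> {0..<1}"
    using N(3) by (auto simp: sets_restrict_space)
  have "emeasure circle_measure (unit_rep -` N)
      = emeasure (restrict_space lborel {0..<1}) (to_circle -` unit_rep -` N \<inter> {0..<1})"
    unfolding circle_measure_def using measurable_sets[OF measurable_unit_rep N'(1)]
    by (subst emeasure_distr[OF measurable_to_circle_restrict]) (auto simp: space_restrict_space)
  also have "to_circle -` unit_rep -` N \<inter> {0..<1} = N"
    using N'(2) by (auto simp: unit_rep_to_circle)
  finally have "emeasure circle_measure (unit_rep -` N) = 0"
    using N(2) by simp
  moreover have "unit_rep c \<in> {0..<1}" for c
    by (simp add: unit_rep_def frac_lt_1)
  ultimately show ?thesis
    using N(1) measurable_sets[OF measurable_unit_rep N'(1)]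
    by (intro AE_I[where N = "unit_rep -` N"]) (auto simp: space_restrict_space circle_measure_def)
qed

interpretation circle: prob_space circle_measure
  by (rule prob_space_circle_measure)

interpretation torus: pair_prob_space circle_measure circle_measure ..

lemma AE_torus_measureI:
  assumes "AE y in restrict_space lborel {0..<1}. Q y"
  shows "AE z in torus_measure. Q (unit_rep (snd z))"
proof -
  obtain N where N: "{c \<in> space circle_measure. \<not> Q (unit_rep c)} \<subseteq> N"
    "emeasure circle_measure N = 0" "N \<in> sets circle_measure"
    using AE_circle_measureI[OF assms] by (rule AE_E)
  have "AE y in circle_measure. y \<notin> N"
    using N by (intro AE_not_in) auto
  \<comment> \<open>Fubini needs a measurable predicate; avoiding N is one, while \<open>Q\<close>
    itself may not be.\<close>
  then have "AE z in torus_measure. snd z \<notin> N"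
    unfolding torus_measure_def using N(3) by (intro torus.AE_pair_measure) auto
  then show ?thesis
    by (rule AE_mp) (use N(1) in \<open>auto simp: circle_measure_def intro!: AE_I2\<close>)
qed

section \<open>Reduction to the kernel and convergence along sparse sets of primes\<close>

lemma to_circle_add: "to_circle x + to_circle y = to_circle (x + y)"
  by (rule plus_circle.abs_eq)

lemma shear_power: "(shear ^^ n) (to_circle x, to_circle y) = (to_circle (x + real n * y), to_circle y)"
  by (induction n) (simp_all add: shear_def to_circle_add algebra_simps)

text \<open>Along the orbit x + n y, every summand contains the same factor e(x) of modulus 1. The
  modulus of the average therefore depends on y alone.\<close>

lemma norm_weighted_avg:
  "norm (weighted_avg a p z) = dirichlet_mean p (unit_rep (snd z) - of_int (a p) / real p)"
proof -
  define x y where "x = unit_rep (fst z)" and "y = unit_rep (snd z)"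
  have z: "z = (to_circle x, to_circle y)"
    by (simp add: x_def y_def)
  have "weight a p (int n) * phi ((shear ^^ n) z)
      = expi x * expi (real n * (y - of_int (a p) / real p))" for n
    by (simp add: z shear_power phi_def circle_expi.abs_eq weight_def expi_add[symmetric] algebra_simps)
  then show ?thesis
    by (simp add: weighted_avg_def dirichlet_mean_def y_def[symmetric] sum_distrib_left[symmetric]
        norm_mult norm_divide)
qed

text \<open>The squares have integrals at most 1/p, so their sum over \<open>P\<close> has finite
  integral and is finite almost everywhere; the terms of a convergent series tend to 0. The shifts
  \<open>c p\<close> may vary freely, since the integral does not see them.\<close>

lemma AE_dirichlet_mean_tendsto_0:
  fixes c :: "nat \<Rightarrow> real"
  assumes pos: "\<And>p. p \<in> P \<Longrightarrow> p > 0" and summ: "(\<lambda>p. 1 / real p) summable_on P"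
  shows "AE y in restrict_space lborel {0..<1}. ((\<lambda>p. dirichlet_mean p (y - c p)) \<longlongrightarrow> 0) (at_top_along P)"
proof -
  \<comment> \<open>Extension by 0 outside \<open>P\<close> turns the sum over \<open>P\<close> into
    an ordinary series over all naturals.\<close>
  define h where "h p y = (if p \<in> P then (dirichlet_mean p (y - c p))\<^sup>2 else 0)" for p y
  have h_meas [measurable]: "h p \<in> borel_measurable borel" for p
    unfolding h_def[abs_def] by (cases "p \<in> P") simp_all
  have h_le: "(\<integral>\<^sup>+y. ennreal (h p y) \<partial>restrict_space lborel {0..<1})
      \<le> ennreal (if p \<in> P then 1 / real p else 0)" for p
  proof (cases "p \<in> P")
    case True
    have "(\<integral>\<^sup>+y. ennreal (h p y) \<partial>restrict_space lborel {0..<1})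
        \<le> (\<integral>\<^sup>+y. ennreal ((dirichlet_mean p (y - c p))\<^sup>2) * indicator {0..1} y \<partial>lborel)"
      using True by (subst nn_integral_restrict_space)
        (auto intro!: nn_integral_mono simp: h_def split: split_indicator)
    then show ?thesis
      using True pos by (simp add: nn_integral_dirichlet_mean_squared)
  qed (simp add: h_def)
  have "(\<lambda>p. if p \<in> P then 1 / real p else 0) summable_on UNIV"
    using summ by (subst summable_on_cong_neutral[where T = P and g = "\<lambda>p. 1 / real p"]) auto
  then have s: "summable (\<lambda>p. if p \<in> P then 1 / real p else 0)"
    by (rule summable_on_imp_summable)
  have "(\<integral>\<^sup>+y. (\<Sum>p. ennreal (h p y)) \<partial>restrict_space lborel {0..<1})
      = (\<Sum>p. \<integral>\<^sup>+y. ennreal (h p y) \<partial>restrict_space lborel {0..<1})"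
    by (intro nn_integral_suminf measurable_restrict_space1) simp
  also have "\<dots> \<le> (\<Sum>p. ennreal (if p \<in> P then 1 / real p else 0))"
    by (intro suminf_le h_le) auto
  also have "\<dots> < \<infinity>"
    using s by (subst suminf_ennreal2) auto
  finally have "AE y in restrict_space lborel {0..<1}. (\<Sum>p. ennreal (h p y)) \<noteq> \<infinity>"
    by (intro nn_integral_PInf_AE measurable_restrict_space1) auto
  then show ?thesis
  proof eventually_elim
    case (elim y)
    have "summable (\<lambda>p. h p y)"
      using elim by (intro summable_suminf_not_top) (auto simp: h_def)
    then have "(\<lambda>p. sqrt (h p y)) \<longlonglongrightarrow> sqrt 0"
      by (intro tendsto_real_sqrt summable_LIMSEQ_zero)
    then have "((\<lambda>p. sqrt (h p y)) \<longlongrightarrow> 0) (at_top_along P)"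
      unfolding at_top_along_def by (simp add: tendsto_mono[OF inf_le1])
    moreover have "\<forall>\<^sub>F p in at_top_along P. sqrt (h p y) = dirichlet_mean p (y - c p)"
      unfolding at_top_along_def eventually_inf_principal by (simp add: h_def dirichlet_mean_def)
    ultimately show ?case
      by (rule Lim_transform_eventually)
  qed
qed

lemma summable_on_inverse_primes:
  assumes P: "P \<subseteq> {p. prime p}" and summ: "(\<lambda>p. ln (real p) / real p) summable_on P"
  shows "(\<lambda>p. 1 / real p) summable_on P"
proof (rule summable_on_comparison_test)
  show "(\<lambda>p. 1 / ln 2 * (ln (real p) / real p)) summable_on P"
    by (rule summable_on_cmult_right[OF summ])
  fix p assume "p \<in> P"
  then have "p \<ge> 2" using P prime_ge_2_nat by auto
  then have "ln 2 \<le> ln (real p)" by simp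
  with \<open>p \<ge> 2\<close> show "1 / real p \<le> 1 / ln 2 * (ln (real p) / real p)"
    by (simp add: field_simps)
qed simp

lemma AE_weighted_avg_tendsto_0:
  assumes P: "P \<subseteq> {p. prime p}" and summ: "(\<lambda>p. ln (real p) / real p) summable_on P"
  shows "AE z in torus_measure. ((\<lambda>p. weighted_avg a p z) \<longlongrightarrow> 0) (at_top_along P)"
proof -
  have "AE y in restrict_space lborel {0..<1}.
      ((\<lambda>p. dirichlet_mean p (y - of_int (a p) / real p)) \<longlongrightarrow> 0) (at_top_along P)"
    using P by (intro AE_dirichlet_mean_tendsto_0 summable_on_inverse_primes[OF P summ])
      (auto simp: prime_gt_0_nat)
  from AE_torus_measureI[OF this] show ?thesis
    by (simp flip: norm_weighted_avg add: tendsto_norm_zero_iff)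
qed

section \<open>Divergence along all primes\<close>

text \<open>Provides a subsequence along which the limit is already known to be 0. As log n / n
  tends to 0 and primes are unbounded, increasing primes \<open>r k\<close> can be chosen with terms
  below 2^(-k).\<close>

lemma exists_sparse_primes:
  "\<exists>P :: nat set. P \<subseteq> {p. prime p} \<and> infinite P \<and> (\<lambda>p. ln (real p) / real p) summable_on P"
proof -
  have lim: "(\<lambda>n::nat. ln (real n) / real n) \<longlonglongrightarrow> 0"
    by (rule lim_ln_over_n)
  have ex: "\<exists>p. (prime p \<and> ln (real p) / real p < (1 / 2) ^ k) \<and> q < p" for k q :: nat
  proof -
    have "\<forall>\<^sub>F n::nat in sequentially. ln (real n) / real n < (1 / 2) ^ k"
      by (rule order_tendstoD(2)[OF lim]) simp
    then obtain N where N: "\<And>n. n \<ge> N \<Longrightarrow> ln (real n) / real n < (1 / 2) ^ k"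
      by (auto simp: eventually_sequentially)
    obtain p where "prime p" "max N q < p"
      using bigger_prime by blast
    then show ?thesis using N[of p] by auto
  qed
  obtain r where r: "\<And>k. prime (r k) \<and> ln (real (r k)) / real (r k) < (1 / 2) ^ k"
      "\<And>k. r k < r (Suc k)"
    using dependent_nat_choice[of "\<lambda>k p. prime p \<and> ln (real p) / real p < (1 / 2) ^ k"
        "\<lambda>_ q p. q < p"] ex by metis
  have "strict_mono r"
    using r(2) by (simp add: strict_mono_Suc_iff)
  then have inj: "inj r"
    by (rule strict_mono_imp_inj_on)
  have nonneg: "0 \<le> ln (real (r k)) / real (r k)" for k
    using r(1)[of k] prime_gt_0_nat[of "r k"] by auto
  have "summable (\<lambda>k. ln (real (r k)) / real (r k))"
  proof (rule summable_comparison_test'[of "\<lambda>k. (1 / 2) ^ k" 0])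
    fix k :: nat
    show "norm (ln (real (r k)) / real (r k)) \<le> (1 / 2) ^ k"
      using r(1)[of k] nonneg[of k] by (simp only: real_norm_def abs_of_nonneg less_imp_le)
  qed simp
  then have "(\<lambda>k. ln (real (r k)) / real (r k)) summable_on UNIV"
    by (rule summable_nonneg_imp_summable_on) (rule nonneg)
  then have "(\<lambda>p. ln (real p) / real p) summable_on range r"
    by (simp add: summable_on_reindex[OF inj] o_def)
  moreover have "infinite (range r)"
    using inj by (rule range_inj_infinite)
  ultimately show ?thesis
    using r(1) by (intro exI[of _ "range r"]) auto
qed

lemma at_top_along_neq_bot:
  assumes "infinite P"
  shows "at_top_along P \<noteq> bot"
  using assms unfolding at_top_along_def trivial_limit_def eventually_inf_principal
  by (auto simp: eventually_sequentially infinite_nat_iff_unbounded_le)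

lemma AE_infinite_approx_torus:
  fixes a :: "nat \<Rightarrow> int"
  assumes "AE x in lebesgue_on {0..1::real}.
      infinite {p :: nat. prime p \<and> \<bar>x - of_int (a p) / of_nat p\<bar> \<le> 1 / (2 * of_nat p)}"
  shows "AE z in torus_measure. infinite {p. prime p \<and> 1 / 3 \<le> norm (weighted_avg a p z)}"
proof -
  let ?Q = "\<lambda>x :: real. infinite {p :: nat. prime p \<and> \<bar>x - of_int (a p) / of_nat p\<bar> \<le> 1 / (2 * of_nat p)}"
  have "AE x in lebesgue. x \<in> {0..1} \<longrightarrow> ?Q x"
    using assms by (simp add: AE_restrict_space_iff)
  \<comment> \<open>Every Lebesgue null set lies in a Borel null set, so both measures have the same
    almost-everywhere statements.\<close>
  then have "AE x in lborel. x \<in> {0..1} \<longrightarrow> ?Q x"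
    by (simp add: AE_completion_iff)
  then have "AE x in restrict_space lborel {0..<1}. ?Q x"
    by (auto simp: AE_restrict_space_iff)
  then have "AE z in torus_measure. ?Q (unit_rep (snd z))"
    by (rule AE_torus_measureI)
  then show ?thesis
  proof eventually_elim
    case (elim z)
    have "1 / 3 \<le> norm (weighted_avg a p z)"
      if "prime p" "\<bar>unit_rep (snd z) - of_int (a p) / of_nat p\<bar> \<le> 1 / (2 * of_nat p)" for p
      unfolding norm_weighted_avg using that by (intro dirichlet_mean_ge) (simp_all add: prime_gt_0_nat)
    then show ?case
      by (intro infinite_super[OF _ elim]) auto
  qed
qed

text \<open>A limit along all primes must equal the limit 0 along a sparse subset, which contradicts
  modulus at least 1/3 for infinitely many primes.\<close>

lemma not_AE_weighted_avg_convergent: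
  fixes a :: "nat \<Rightarrow> int"
  assumes "AE x in lebesgue_on {0..1::real}.
      infinite {p :: nat. prime p \<and> \<bar>x - of_int (a p) / of_nat p\<bar> \<le> 1 / (2 * of_nat p)}"
  shows "\<not> (AE z in torus_measure. \<exists>L.
            ((\<lambda>p. weighted_avg a p z) \<longlongrightarrow> L) (at_top_along {p. prime p}))"
proof
  assume conv: "AE z in torus_measure. \<exists>L.
            ((\<lambda>p. weighted_avg a p z) \<longlongrightarrow> L) (at_top_along {p. prime p})"
  obtain P :: "nat set" where P: "P \<subseteq> {p. prime p}" "infinite P"
      "(\<lambda>p. ln (real p) / real p) summable_on P"
    using exists_sparse_primes by blast
  have "AE z in torus_measure. False"
    using conv AE_weighted_avg_tendsto_0[OF P(1,3), of a] AE_infinite_approx_torus[OF assms]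
  proof eventually_elim
    case (elim z)
    then obtain L where L: "((\<lambda>p. weighted_avg a p z) \<longlongrightarrow> L) (at_top_along {p. prime p})"
      by blast
    have sub: "at_top_along Q \<le> at_top_along {p. prime p}" if "Q \<subseteq> {p. prime p}" for Q :: "nat set"
      using that by (auto simp: at_top_along_def intro: le_infI2)
    have "((\<lambda>p. weighted_avg a p z) \<longlongrightarrow> L) (at_top_along P)"
      by (rule tendsto_mono[OF sub[OF P(1)] L])
    then have "L = 0"
      using elim(2) at_top_along_neq_bot[OF P(2)] tendsto_unique by blast
    \<comment> \<open>\<open>S\<close> depends on the point z; it is infinite for almost every z, so
      its filter is proper and the bound 1/3 passes to the limit.\<close>
    define S where "S = {p. prime p \<and> 1 / 3 \<le> norm (weighted_avg a p z)}"
    have "((\<lambda>p. norm (weighted_avg a p z)) \<longlongrightarrow> 0) (at_top_along S)"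
      by (rule tendsto_norm_zero[OF tendsto_mono[OF sub L[unfolded \<open>L = 0\<close>]]]) (auto simp: S_def)
    then have "(1 / 3 :: real) \<le> 0"
    proof (rule tendsto_lowerbound)
      show "\<forall>\<^sub>F p in at_top_along S. 1 / 3 \<le> norm (weighted_avg a p z)"
        unfolding at_top_along_def eventually_inf_principal by (simp add: S_def)
      show "at_top_along S \<noteq> bot"
        using elim(3) by (intro at_top_along_neq_bot) (simp add: S_def)
    qed
    then show False by simp
  qed
  \<comment> \<open>On a space of total mass 1, a contradiction cannot hold almost
    everywhere.\<close>
  then show False
    unfolding torus_measure_def by (simp only: torus.P.AE_False)
qed

theorem proposition2p1:
  fixes a :: "nat \<Rightarrow> int"
  assumes a_range: "\<And>p. prime p \<Longrightarrow> 0 \<le> a p \<and> a p < int p"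
    and a_approx: "AE x in lebesgue_on {0..1::real}.
      infinite {p :: nat. prime p \<and> \<bar>x - of_int (a p) / of_nat p\<bar> \<le> 1 / (2 * of_nat p)}"
  shows "(\<not> (AE z in torus_measure. \<exists>L.
            ((\<lambda>p. weighted_avg a p z) \<longlongrightarrow> L) (at_top_along {p. prime p})))
    \<and> (\<forall>P :: nat set. P \<subseteq> {p. prime p} \<and> infinite P \<and> (\<lambda>p. ln (real p) / real p) summable_on P
        \<longrightarrow> (AE z in torus_measure. ((\<lambda>p. weighted_avg a p z) \<longlongrightarrow> 0) (at_top_along P)))"
  using not_AE_weighted_avg_convergent[OF a_approx] AE_weighted_avg_tendsto_0 by blast

end
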